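(* For $a\in(0,1/2]$ define $f_a\in C[0,1]$ by $f_a(x):=1$ for $0\le x\le a$, $f_a(x):=2-x/a$ for $a\le x\le 2a$, and $f_a(x):=0$ for $2a\le x\le1$. Let $p,q\in[1,\infty)$ and let $X_N$ be a linear subspace of $C[0,1]$ that contains the functions $f_a$ and $f_{a/2}$ for some $a\in(0,1/2]$. Let $D>0$, $m\in\mathbb N$, and suppose that points $\xi^1,\dots,\xi^m\in[0,1]$ (not necessarily distinct) are such that $$0<\left(\frac1m\sum_{j=1}^m|f(\xi^j)|^q\right)^{1/q}\le D\|f\|_p\qquad\text{for all } f\in X_N\setminus\{0\}.$$ Then $$m\ge D^{-q}(2a)^{-q/p}.$$
   Context: $\|f\|_p=\left(\int_0^1|f(x)|^p\,dx\right)^{1/p}$ is the $L_p$-norm on $[0,1]$ with Lebesgue measure. *)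

theory Defs
  imports "HOL-Analysis.Analysis"
begin

text \<open>
  The real vector space C[0,1] is realised inside the bounded continuous functions on the real line:
  a continuous function on [0,1] is identified with its extension that is constant on each side of
  the interval.  So \<open>f = 0\<close> in this space iff \<open>f\<close> vanishes on [0,1], and linear subspaces of
  C[0,1] are the sets \<open>X \<subseteq> C01\<close> with \<open>subspace X\<close>.
\<close>

definition C01 :: "(real \<Rightarrow>\<^sub>C real) set" where
  "C01 = {f. \<forall>x. apply_bcontfun f x = apply_bcontfun f (clamp 0 1 x)}"

definition to_C01 :: "(real \<Rightarrow> real) \<Rightarrow> (real \<Rightarrow>\<^sub>C real)" where
  "to_C01 f = Bcontfun (ext_cont f 0 1)"

lemma apply_to_C01_clamp:
  assumes "continuous_on {0..1} f"
  shows "apply_bcontfun (to_C01 f) x = f (clamp 0 1 x)"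
proof -
  have cont: "continuous_on (cbox 0 1) f"
    using assms by simp
  have "bounded (f ` cbox 0 1)"
    using compact_imp_bounded[OF compact_continuous_image[OF cont compact_cbox]] .
  then have "bounded (range (ext_cont f 0 1))"
    unfolding ext_cont_def by (rule clamp_bounded)
  then have "ext_cont f 0 1 \<in> bcontfun"
    using continuous_on_ext_cont[OF cont] by (simp add: bcontfun_def)
  then show ?thesis
    by (simp add: to_C01_def Bcontfun_inverse ext_cont_def)
qed

lemma apply_to_C01:
  assumes "continuous_on {0..1} f" "x \<in> {0..1}"
  shows "apply_bcontfun (to_C01 f) x = f x"
  using assms by (simp add: apply_to_C01_clamp)

lemma clamp_01: "clamp 0 1 (x::real) \<in> {0..1}"
  using clamp_in_interval[of "0::real" 1 x] by simp

lemma to_C01_mem: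
  assumes "continuous_on {0..1} f"
  shows "to_C01 f \<in> C01"
  using assms clamp_01 by (simp add: C01_def apply_to_C01_clamp)

lemma C01_eq_iff:
  assumes "f \<in> C01" "g \<in> C01"
  shows "f = g \<longleftrightarrow> (\<forall>x\<in>{0..1}. apply_bcontfun f x = apply_bcontfun g x)"
proof (intro iffI bcontfun_eqI)
  fix x assume "\<forall>x\<in>{0..1}. apply_bcontfun f x = apply_bcontfun g x"
  then have "apply_bcontfun f (clamp 0 1 x) = apply_bcontfun g (clamp 0 1 x)"
    using clamp_01 by blast
  then show "apply_bcontfun f x = apply_bcontfun g x"
    using assms by (metis (mono_tags, lifting) C01_def mem_Collect_eq)
qed simp

lemma subspace_C01: "subspace C01"
  by (auto simp: subspace_def C01_def)

definition plateau :: "real \<Rightarrow> real \<Rightarrow> real" where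
  "plateau a x = (if x \<le> a then 1 else if x \<le> 2 * a then 2 - x / a else 0)"

lemma continuous_on_plateau:
  assumes "a > 0"
  shows "continuous_on S (plateau a)"
proof -
  have "plateau a = (\<lambda>x. max 0 (min 1 (2 - x / a)))"
    using assms by (auto simp: fun_eq_iff plateau_def min_def max_def field_simps)
  then show ?thesis
    using assms by (auto intro!: continuous_intros)
qed

definition plateau_C01 :: "real \<Rightarrow> (real \<Rightarrow>\<^sub>C real)" where
  "plateau_C01 a = to_C01 (plateau a)"

lemma plateau_C01_mem: "a > 0 \<Longrightarrow> plateau_C01 a \<in> C01"
  by (simp add: plateau_C01_def to_C01_mem continuous_on_plateau)

lemma apply_plateau_C01:
  "a > 0 \<Longrightarrow> x \<in> {0..1} \<Longrightarrow> apply_bcontfun (plateau_C01 a) x = plateau a x"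
  by (simp add: plateau_C01_def apply_to_C01 continuous_on_plateau)

definition Lp_norm :: "real \<Rightarrow> (real \<Rightarrow>\<^sub>C real) \<Rightarrow> real" where
  "Lp_norm p f = (LINT x:{0..1}|lborel. \<bar>apply_bcontfun f x\<bar> powr p) powr (1 / p)"

end

theory Submission
  imports Defs
begin

text \<open>
  The function $f_{a/2}$ vanishes outside $[0,a)$, so the lower bound forces some sample point into
  $[0,a)$. There $f_a = 1$, so the discrete norm of $f_a$ is at least $m^{-1/q}$, whereas
  $\|f_a\|_p \<le> (2a)^{1/p}$.
\<close>

text \<open>The value at 0 is 1. This makes the sampling inequalities, assumed for nonzero members
  of \<open>X\<close>, available for both plateau functions.\<close>

lemma plateau_C01_nonzero:
  assumes "a > 0"
  shows "plateau_C01 a \<noteq> 0"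
proof
  assume "plateau_C01 a = 0"
  moreover have "apply_bcontfun (plateau_C01 a) 0 = 1"
    using assms by (simp add: apply_plateau_C01 plateau_def)
  ultimately show False by simp
qed

lemma abs_plateau_le_indicator:
  assumes "a > 0" "x \<ge> 0"
  shows "\<bar>plateau a x\<bar> \<le> indicator {0..2 * a} x"
  using assms by (auto simp: plateau_def indicator_def field_simps)

text \<open>The integrand is dominated by the indicator of [0, 2a], an interval of length
  2a.\<close>

lemma Lp_norm_plateau_le:
  assumes "1 \<le> p" "0 < a"
  shows "Lp_norm p (plateau_C01 a) \<le> (2 * a) powr (1 / p)"
proof -
  have "(LINT x:{0..1}|lborel. \<bar>apply_bcontfun (plateau_C01 a) x\<bar> powr p)
      \<le> (LINT x|lborel. indicator {0..2 * a} x)"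
    unfolding set_lebesgue_integral_def
  \<comment> \<open>This rule asks for an integrable, nonnegative majorant; a non-integrable
    function would have Bochner integral 0.\<close>
  proof (rule integral_mono')
    fix x :: real
    show "indicator {0..1} x *\<^sub>R \<bar>apply_bcontfun (plateau_C01 a) x\<bar> powr p \<le> indicator {0..2 * a} x"
    proof (cases "x \<in> {0..1}")
      case True
      have "\<bar>plateau a x\<bar> powr p \<le> indicator {0..2 * a} x powr p"
        using abs_plateau_le_indicator[of a x] True assms by (intro powr_mono2) auto
      \<comment> \<open>The values 0 and 1 are fixed by \<open>powr p\<close>, since
        \<open>0 powr p = 0\<close>.\<close>
      also have "\<dots> = indicator {0..2 * a} x"
        by (simp add: indicator_def)
      finally show ?thesis
        using True assms by (simp add: apply_plateau_C01)
    qed simp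
  qed (use assms in simp_all)
  also have "\<dots> = 2 * a"
    using assms by simp
  finally show ?thesis
    unfolding Lp_norm_def set_lebesgue_integral_def
    using assms by (intro powr_mono2) (auto intro!: Bochner_Integration.integral_nonneg)
qed

theorem proposition2p3:
  fixes a p q D :: real and m :: nat and \<xi> :: "nat \<Rightarrow> real"
    and X :: "(real \<Rightarrow>\<^sub>C real) set"
  assumes "1 \<le> p" and "1 \<le> q"
    and "0 < a" and "a \<le> 1 / 2"
    and "X \<subseteq> C01" and "subspace X"
    and "plateau_C01 a \<in> X" and "plateau_C01 (a / 2) \<in> X"
    and "0 < D" and "1 \<le> m"
    and "\<forall>j\<in>{1..m}. \<xi> j \<in> {0..1}"
    and "\<forall>f\<in>X - {0}.
           0 < (1 / real m * (\<Sum>j=1..m. \<bar>apply_bcontfun f (\<xi> j)\<bar> powr q)) powr (1 / q) \<and>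
           (1 / real m * (\<Sum>j=1..m. \<bar>apply_bcontfun f (\<xi> j)\<bar> powr q)) powr (1 / q)
             \<le> D * Lp_norm p f"
  shows "real m \<ge> D powr (- q) * (2 * a) powr (- q / p)"
proof -
  let ?S = "\<lambda>f. \<Sum>j=1..m. \<bar>apply_bcontfun f (\<xi> j)\<bar> powr q"
  have "0 < (1 / real m * ?S (plateau_C01 (a / 2))) powr (1 / q)"
    using assms(12) assms(8) plateau_C01_nonzero[of "a / 2"] assms(3) by auto
  \<comment> \<open>Here and in the next step \<open>0 powr r = 0\<close> is decisive: a zero sum
    would make the root 0, and zero samples would make every summand 0.\<close>
  then have "?S (plateau_C01 (a / 2)) \<noteq> 0"
    by auto
  then obtain j where j: "j \<in> {1..m}" "apply_bcontfun (plateau_C01 (a / 2)) (\<xi> j) \<noteq> 0"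
    by (metis (mono_tags, lifting) abs_zero powr_0 sum.neutral)
  then have "plateau (a / 2) (\<xi> j) \<noteq> 0" "\<xi> j \<in> {0..1}"
    using assms(3,11) by (auto simp: apply_plateau_C01)
  then have "apply_bcontfun (plateau_C01 a) (\<xi> j) = 1"
    using assms(3) by (auto simp: apply_plateau_C01 plateau_def split: if_splits)
  \<comment> \<open>All summands are nonnegative and the one at \<open>j\<close> is already
    1.\<close>
  then have "1 \<le> ?S (plateau_C01 a)"
    using member_le_sum[OF j(1), of "\<lambda>j. \<bar>apply_bcontfun (plateau_C01 a) (\<xi> j)\<bar> powr q"] by simp
  then have "(1 / real m) powr (1 / q) \<le> (1 / real m * ?S (plateau_C01 a)) powr (1 / q)"
    using assms(2,10) by (intro powr_mono2) (auto simp: field_simps)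
  also have "\<dots> \<le> D * Lp_norm p (plateau_C01 a)"
    using assms(12) assms(7) plateau_C01_nonzero[OF assms(3)] by auto
  also have "\<dots> \<le> D * (2 * a) powr (1 / p)"
    using Lp_norm_plateau_le[OF assms(1,3)] assms(9) by simp
  \<comment> \<open>Taking q-th powers leaves 1/m on the left; reciprocals then give the bound on
    m.\<close>
  finally have "((1 / real m) powr (1 / q)) powr q \<le> (D * (2 * a) powr (1 / p)) powr q"
    using assms(2) by (intro powr_mono2) auto
  then have "1 / real m \<le> D powr q * (2 * a) powr (q / p)"
    using assms(2,3,9,10) by (simp add: powr_powr powr_mult)
  then have "1 / (D powr q * (2 * a) powr (q / p)) \<le> real m"
    using assms(3,9,10) by (simp add: field_simps)
  then show ?thesis
    by (simp add: powr_minus divide_inverse)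
qed

end
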